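(* Let $\tau:\mathbb{U}\to\Omega$, $\tau(z)=\frac{az+b}{cz+d}$, be a linear fractional Riemann map with real coefficients $a,b,c,d$, and let $\Phi$ be an analytic self-map of $\Omega$ such that $C_{\Phi}$ is $J_{\Omega}$-symmetric on $H^{2}(\Omega)$. (1) If $|c|^{2}=|d|^{2}$, then there is $r\in\mathbb{C}$ such that $\Phi(w)=w+r$ for all $w\in\Omega$. (2) If $|c|^{2}\neq|d|^{2}$, then there is $r\in\mathbb{C}$ such that $\Phi(w)=rw+\frac{(r-1)(bd-ac)}{|c|^{2}-|d|^{2}}$ for all $w\in\Omega$. Conversely, suppose that either $|c|^2=|d|^2$ and $\Phi(w)=w+r$ with $r\in\mathbb{C}$, or $|c|^2\neq|d|^2$ and $\Phi(w)=rw+\frac{(r-1)(bd-ac)}{|c|^{2}-|d|^{2}}$ with $r\in\mathbb{C}$. If $\Phi$ is a self-map of $\Omega$ such that $C_{\Phi}$ is bounded on $H^{2}(\Omega)$, then $C_{\Phi}$ is $J_{\Omega}$-symmetric.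
   Context: $\mathbb{U}$ is the open unit disc and $\Omega$ is an open simply connected proper subset of $\mathbb{C}$. A Riemann map $\tau:\mathbb{U}\to\Omega$ is a biholomorphic map of $\mathbb{U}$ onto $\Omega$; it is a linear fractional Riemann map if $\tau(z)=\frac{az+b}{cz+d}$ with $ad-bc\neq0$. The Hardy-Smirnov space $H^{2}(\Omega)$ is the set of analytic $f:\Omega\to\mathbb{C}$ with $\|f\|^{2}=\sup_{0<r<1}\frac{1}{2\pi}\int_{\Gamma_r}|f(w)|^{2}|dw|<\infty$, where $\Gamma_r=\tau(\{|z|=r\})$; the norm is the one induced by the given $\tau$. Fix an analytic branch of $(\tau')^{1/2}$ on $\mathbb{U}$. The map $Vf=(f\circ\tau)(\tau')^{1/2}$ is an isometric isomorphism from $H^2(\Omega)$ onto the classical Hardy space $H^2(\mathbb{U})$, and $H^{2}(\Omega)$ is a Hilbert space with inner product $\langle f,g\rangle=\langle Vf,Vg\rangle_{2}$, where $\langle\cdot,\cdot\rangle_2$ is the inner product of $H^2(\mathbb{U})$, $\langle F,G\rangle_2=\sum_{n\ge0}\widehat F(n)\overline{\widehat G(n)}$ (Maclaurin coefficients). For an analytic self-map $\Phi$ of $\Omega$, $C_{\Phi}f=f\circ\Phi$. A conjugation $C$ on a complex Hilbert space $\mathcal H$ is a conjugate-linear map with $\langle Cf,Cg\rangle=\langle g,f\rangle$ for all $f,g$ and $C^2=Id$. A bounded operator $T$ is $C$-symmetric if $CT=T^*C$. On $H^2(\mathbb{U})$ let $J$ be the conjugation $(Jf)(z)=\overline{f(\overline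 z)}$, and let $J_\Omega=V^{-1}JV$, which is a conjugation on $H^2(\Omega)$. *)

theory Defs
  imports "HOL-Complex_Analysis.Complex_Analysis"
begin

text \<open>
  Operator theory on a complex Hilbert space of complex-valued functions with carrier \<open>H\<close>,
  norm \<open>nrm\<close> and inner product \<open>ip\<close> (linear in the first argument).
\<close>

definition bounded_operator_on ::
    "('a \<Rightarrow> complex) set \<Rightarrow> (('a \<Rightarrow> complex) \<Rightarrow> real) \<Rightarrow>
     (('a \<Rightarrow> complex) \<Rightarrow> ('a \<Rightarrow> complex)) \<Rightarrow> bool" where
  "bounded_operator_on H nrm T \<longleftrightarrow>
     (\<forall>f\<in>H. T f \<in> H) \<and>
     (\<forall>f\<in>H. \<forall>g\<in>H. \<forall>\<alpha> \<beta>. T (\<lambda>x. \<alpha> * f x + \<beta> * g x) = (\<lambda>x. \<alpha> * T f x + \<beta> * T g x)) \<and>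
     (\<exists>M. \<forall>f\<in>H. nrm (T f) \<le> M * nrm f)"

definition adjoint_on ::
    "('a \<Rightarrow> complex) set \<Rightarrow> (('a \<Rightarrow> complex) \<Rightarrow> ('a \<Rightarrow> complex) \<Rightarrow> complex) \<Rightarrow>
     (('a \<Rightarrow> complex) \<Rightarrow> ('a \<Rightarrow> complex)) \<Rightarrow> ('a \<Rightarrow> complex) \<Rightarrow> ('a \<Rightarrow> complex)" where
  "adjoint_on H ip T g = (THE h. h \<in> H \<and> (\<forall>f\<in>H. ip (T f) g = ip f h))"

definition conjugation_on ::
    "('a \<Rightarrow> complex) set \<Rightarrow> (('a \<Rightarrow> complex) \<Rightarrow> ('a \<Rightarrow> complex) \<Rightarrow> complex) \<Rightarrow>
     (('a \<Rightarrow> complex) \<Rightarrow> ('a \<Rightarrow> complex)) \<Rightarrow> bool" where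
  "conjugation_on H ip C \<longleftrightarrow>
     (\<forall>f\<in>H. C f \<in> H) \<and>
     (\<forall>f\<in>H. \<forall>g\<in>H. \<forall>\<alpha> \<beta>.
        C (\<lambda>x. \<alpha> * f x + \<beta> * g x) = (\<lambda>x. cnj \<alpha> * C f x + cnj \<beta> * C g x)) \<and>
     (\<forall>f\<in>H. \<forall>g\<in>H. ip (C f) (C g) = ip g f) \<and>
     (\<forall>f\<in>H. C (C f) = f)"

definition C_symmetric_on ::
    "('a \<Rightarrow> complex) set \<Rightarrow> (('a \<Rightarrow> complex) \<Rightarrow> real) \<Rightarrow>
     (('a \<Rightarrow> complex) \<Rightarrow> ('a \<Rightarrow> complex) \<Rightarrow> complex) \<Rightarrow>
     (('a \<Rightarrow> complex) \<Rightarrow> ('a \<Rightarrow> complex)) \<Rightarrow>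
     (('a \<Rightarrow> complex) \<Rightarrow> ('a \<Rightarrow> complex)) \<Rightarrow> bool" where
  "C_symmetric_on H nrm ip C T \<longleftrightarrow>
     conjugation_on H ip C \<and> bounded_operator_on H nrm T \<and>
     (\<forall>f\<in>H. C (T f) = adjoint_on H ip T (C f))"


abbreviation unit_disc :: "complex set" where
  "unit_disc \<equiv> ball 0 1"

definition riemann_map :: "complex set \<Rightarrow> (complex \<Rightarrow> complex) \<Rightarrow> bool" where
  "riemann_map \<Omega> \<tau> \<longleftrightarrow>
     \<tau> holomorphic_on unit_disc \<and> bij_betw \<tau> unit_disc \<Omega> \<and>
     inv_into unit_disc \<tau> holomorphic_on \<Omega>"

text \<open>
  No value at a pole is prescribed: if \<open>c * z + d\<close> vanished in the disc, \<open>\<tau>\<close> would be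
  unbounded there, so it could not be a Riemann map.
\<close>
definition linear_fractional_riemann_map ::
    "complex set \<Rightarrow> (complex \<Rightarrow> complex) \<Rightarrow> complex \<Rightarrow> complex \<Rightarrow> complex \<Rightarrow> complex \<Rightarrow> bool" where
  "linear_fractional_riemann_map \<Omega> \<tau> a b c d \<longleftrightarrow>
     riemann_map \<Omega> \<tau> \<and> a * d - b * c \<noteq> 0 \<and>
     (\<forall>z\<in>unit_disc. \<tau> z = (a * z + b) / (c * z + d))"


definition arclength_integral :: "(real \<Rightarrow> complex) \<Rightarrow> (complex \<Rightarrow> real) \<Rightarrow> real" where
  "arclength_integral \<gamma> g =
     integral {0..1} (\<lambda>t. g (\<gamma> t) * norm (vector_derivative \<gamma> (at t within {0..1})))"

definition hs_mean :: "(complex \<Rightarrow> complex) \<Rightarrow> (complex \<Rightarrow> complex) \<Rightarrow> real \<Rightarrow> real" where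
  "hs_mean \<tau> f r = 1 / (2 * pi) * arclength_integral (\<tau> \<circ> circlepath 0 r) (\<lambda>w. (norm (f w))\<^sup>2)"

text \<open>
  An analytic function on \<open>\<Omega>\<close> is represented by its extension by zero to the whole plane, so
  that equality of elements of the space is equality of functions.
\<close>
definition hardy_smirnov :: "complex set \<Rightarrow> (complex \<Rightarrow> complex) \<Rightarrow> (complex \<Rightarrow> complex) set" where
  "hardy_smirnov \<Omega> \<tau> =
     {f. f holomorphic_on \<Omega> \<and> (\<forall>w. w \<notin> \<Omega> \<longrightarrow> f w = 0) \<and> bdd_above (hs_mean \<tau> f ` {0<..<1})}"

definition hs_norm :: "(complex \<Rightarrow> complex) \<Rightarrow> (complex \<Rightarrow> complex) \<Rightarrow> real" where
  "hs_norm \<tau> f = sqrt (SUP r\<in>{0<..<1}. hs_mean \<tau> f r)"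

definition maclaurin_coeff :: "(complex \<Rightarrow> complex) \<Rightarrow> nat \<Rightarrow> complex" where
  "maclaurin_coeff F n = (deriv ^^ n) F 0 / fact n"

definition hardy_inner :: "(complex \<Rightarrow> complex) \<Rightarrow> (complex \<Rightarrow> complex) \<Rightarrow> complex" where
  "hardy_inner F G = (\<Sum>n. maclaurin_coeff F n * cnj (maclaurin_coeff G n))"

text \<open>In the following, \<open>s\<close> stands for the chosen branch of the square root of \<open>\<tau>'\<close>.\<close>

definition hs_V ::
    "(complex \<Rightarrow> complex) \<Rightarrow> (complex \<Rightarrow> complex) \<Rightarrow> (complex \<Rightarrow> complex) \<Rightarrow> complex \<Rightarrow> complex" where
  "hs_V \<tau> s f = (\<lambda>z. if z \<in> unit_disc then f (\<tau> z) * s z else 0)"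

definition hs_inner ::
    "(complex \<Rightarrow> complex) \<Rightarrow> (complex \<Rightarrow> complex) \<Rightarrow>
     (complex \<Rightarrow> complex) \<Rightarrow> (complex \<Rightarrow> complex) \<Rightarrow> complex" where
  "hs_inner \<tau> s f g = hardy_inner (hs_V \<tau> s f) (hs_V \<tau> s g)"

definition hardy_J :: "(complex \<Rightarrow> complex) \<Rightarrow> complex \<Rightarrow> complex" where
  "hardy_J F = (\<lambda>z. cnj (F (cnj z)))"

definition hs_J ::
    "complex set \<Rightarrow> (complex \<Rightarrow> complex) \<Rightarrow> (complex \<Rightarrow> complex) \<Rightarrow>
     (complex \<Rightarrow> complex) \<Rightarrow> complex \<Rightarrow> complex" where
  "hs_J \<Omega> \<tau> s f = inv_into (hardy_smirnov \<Omega> \<tau>) (hs_V \<tau> s) (hardy_J (hs_V \<tau> s f))"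

definition comp_op ::
    "complex set \<Rightarrow> (complex \<Rightarrow> complex) \<Rightarrow> (complex \<Rightarrow> complex) \<Rightarrow> complex \<Rightarrow> complex" where
  "comp_op \<Omega> \<Phi> f = (\<lambda>w. if w \<in> \<Omega> then f (\<Phi> w) else 0)"

definition comp_op_bounded ::
    "complex set \<Rightarrow> (complex \<Rightarrow> complex) \<Rightarrow> (complex \<Rightarrow> complex) \<Rightarrow> bool" where
  "comp_op_bounded \<Omega> \<tau> \<Phi> \<longleftrightarrow>
     bounded_operator_on (hardy_smirnov \<Omega> \<tau>) (hs_norm \<tau>) (comp_op \<Omega> \<Phi>)"

definition comp_op_J_symmetric ::
    "complex set \<Rightarrow> (complex \<Rightarrow> complex) \<Rightarrow> (complex \<Rightarrow> complex) \<Rightarrow> (complex \<Rightarrow> complex) \<Rightarrow> bool" where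
  "comp_op_J_symmetric \<Omega> \<tau> s \<Phi> \<longleftrightarrow>
     C_symmetric_on (hardy_smirnov \<Omega> \<tau>) (hs_norm \<tau>) (hs_inner \<tau> s) (hs_J \<Omega> \<tau> s) (comp_op \<Omega> \<Phi>)"

end

theory Submission imports Defs begin

text \<open>
  Transported to \<open>H\<^sup>2(\<Omega>)\<close>, the Szego kernels give functions \<open>E\<^sub>w\<close> with
  \<open>\<langle>f, J E\<^sub>w\<rangle> = f w\<close>, so that \<open>\<langle>C\<^sub>\<Phi> f, J E\<^sub>w\<rangle> = \<langle>f, J E\<^sub>\<Phi>\<^sub>w\<rangle>\<close>. Since the span of the \<open>E\<^sub>w\<close> is dense, a bounded
  \<open>C\<^sub>\<Phi>\<close> is \<open>J\<close>-symmetric iff \<open>C\<^sub>\<Phi> E\<^sub>w = E\<^sub>\<Phi>\<^sub>w\<close> for all \<open>w\<close>. For linear fractional \<open>\<tau>\<close> one finds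
  \<open>E\<^sub>w z = (a * d - b * c) / Q w z\<close> with a symmetric polynomial \<open>Q\<close> of bidegree \<open>(1, 1)\<close>, and the
  condition becomes the functional equation \<open>Q w (\<Phi> z) = Q (\<Phi> w) z\<close>, whose solutions are
  exactly the affine maps in the statement.
\<close>

section \<open>The Hardy space of the disc\<close>

text \<open>Membership is tested on coefficients rather than integral means;
  \<open>Parseval_circle\<close> and \<open>Abel_sup\<close> reconcile the two. Values off the disc
  are fixed to 0 so that \<open>V\<close> and \<open>V_inv\<close> invert each other as functions on
  the whole plane.\<close>

definition H2 :: "(complex \<Rightarrow> complex) set" where
  "H2 = {F. F holomorphic_on unit_disc \<and> (\<forall>z. z \<notin> unit_disc \<longrightarrow> F z = 0) \<and>
            summable (\<lambda>n. (norm (maclaurin_coeff F n))\<^sup>2)}"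

definition H2_norm :: "(complex \<Rightarrow> complex) \<Rightarrow> real" where
  "H2_norm F = sqrt (\<Sum>n. (norm (maclaurin_coeff F n))\<^sup>2)"

text \<open>The usual Szego kernel at \<open>cnj w\<close>, hence holomorphic in \<open>w\<close> as
  well as in \<open>z\<close>.\<close>

definition szego :: "complex \<Rightarrow> complex \<Rightarrow> complex" where
  "szego w = (\<lambda>z. if z \<in> unit_disc then 1 / (1 - w * z) else 0)"

lemma sums_maclaurin:
  "F holomorphic_on unit_disc \<Longrightarrow> z \<in> unit_disc \<Longrightarrow> (\<lambda>n. maclaurin_coeff F n * z ^ n) sums F z"
  using holomorphic_power_series[of F 0 1 z] by (simp add: maclaurin_coeff_def)

text \<open>Uniqueness of power series coefficients, by way of formal power series at 0.\<close>

lemma maclaurin_coeff_eqI: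
  assumes "\<And>z. z \<in> unit_disc \<Longrightarrow> (\<lambda>n. a n * z ^ n) sums F z"
  shows "maclaurin_coeff F = a"
proof -
  have "eventually (\<lambda>u::complex. u \<in> unit_disc) (nhds 0)"
    by (rule eventually_nhds_in_open) auto
  then have "F has_fps_expansion Abs_fps a"
    by (intro has_fps_expansionI) (auto elim!: eventually_mono intro: assms)
  from fps_nth_fps_expansion[OF this] show ?thesis
    by (auto simp: maclaurin_coeff_def)
qed

lemma H2I:
  assumes "\<And>z. z \<in> unit_disc \<Longrightarrow> (\<lambda>n. a n * z ^ n) sums F z"
    and "\<And>z. z \<notin> unit_disc \<Longrightarrow> F z = 0" and "summable (\<lambda>n. (norm (a n))\<^sup>2)"
  shows "F \<in> H2"
  using assms power_series_holomorphic[of 0 1 a F] maclaurin_coeff_eqI[of a F]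
  by (auto simp: H2_def)

lemma H2_D:
  assumes "F \<in> H2"
  shows H2_holomorphic: "F holomorphic_on unit_disc"
    and H2_outside: "z \<notin> unit_disc \<Longrightarrow> F z = 0"
    and H2_summable: "summable (\<lambda>n. (norm (maclaurin_coeff F n))\<^sup>2)"
  using assms by (auto simp: H2_def)

lemma H2_sums:
  "F \<in> H2 \<Longrightarrow> z \<in> unit_disc \<Longrightarrow> (\<lambda>n. maclaurin_coeff F n * z ^ n) sums F z"
  by (intro sums_maclaurin H2_holomorphic)

lemma H2_norm_nonneg: "0 \<le> H2_norm F" if "F \<in> H2"
  using H2_summable[OF that] by (simp add: H2_norm_def suminf_nonneg)

section \<open>Square-summable sequences\<close>

lemma l2_mult:
  fixes a b :: "nat \<Rightarrow> complex"
  assumes a: "summable (\<lambda>n. (norm (a n))\<^sup>2)" and b: "summable (\<lambda>n. (norm (b n))\<^sup>2)"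
  shows l2_summable_mult: "summable (\<lambda>n. a n * b n)"
    and l2_Cauchy_Schwarz:
      "norm (\<Sum>n. a n * b n) \<le> sqrt (\<Sum>n. (norm (a n))\<^sup>2) * sqrt (\<Sum>n. (norm (b n))\<^sup>2)"
proof -
  let ?M = "sqrt (\<Sum>n. (norm (a n))\<^sup>2) * sqrt (\<Sum>n. (norm (b n))\<^sup>2)"
  \<comment> \<open>Finite Cauchy-Schwarz with a bound independent of \<open>N\<close> yields both
    absolute summability and the estimate.\<close>
  have part: "(\<Sum>n<N. norm (a n * b n)) \<le> ?M" for N
  proof -
    have "(\<Sum>n<N. norm (a n * b n)) \<le> L2_set (\<lambda>n. norm (a n)) {..<N} * L2_set (\<lambda>n. norm (b n)) {..<N}"
      using L2_set_mult_ineq[of "\<lambda>n. norm (a n)" "\<lambda>n. norm (b n)" "{..<N}"]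
      by (simp add: norm_mult)
    also have "\<dots> \<le> ?M"
      unfolding L2_set_def
      by (intro mult_mono real_sqrt_le_mono sum_le_suminf a b) (auto intro: sum_nonneg suminf_nonneg a)
    finally show ?thesis .
  qed
  have s: "summable (\<lambda>n. norm (a n * b n))"
    by (rule summableI_nonneg_bounded[OF _ part]) simp
  then show "summable (\<lambda>n. a n * b n)" by (rule summable_norm_cancel)
  show "norm (\<Sum>n. a n * b n) \<le> ?M"
    using summable_norm[OF s] suminf_le_const[OF s part] by linarith
qed

lemma l2_scale: "summable (\<lambda>n. (norm (\<alpha> * a n))\<^sup>2)"
  if "summable (\<lambda>n. (norm (a n))\<^sup>2)" for a :: "nat \<Rightarrow> complex"
  using summable_mult[OF that, of "(norm \<alpha>)\<^sup>2"] by (simp add: norm_mult power_mult_distrib)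

lemma l2_add:
  fixes a b :: "nat \<Rightarrow> complex"
  assumes "summable (\<lambda>n. (norm (a n))\<^sup>2)" "summable (\<lambda>n. (norm (b n))\<^sup>2)"
  shows "summable (\<lambda>n. (norm (a n + b n))\<^sup>2)"
proof (rule summable_comparison_test')
  show "summable (\<lambda>n. 2 * ((norm (a n))\<^sup>2 + (norm (b n))\<^sup>2))"
    by (intro summable_mult summable_add assms)
  show "norm ((norm (a n + b n))\<^sup>2) \<le> 2 * ((norm (a n))\<^sup>2 + (norm (b n))\<^sup>2)" if "n \<ge> 0" for n
  proof -
    have "(norm (a n + b n))\<^sup>2 \<le> (norm (a n) + norm (b n))\<^sup>2"
      by (intro power_mono norm_triangle_ineq) auto
    also have "\<dots> \<le> 2 * ((norm (a n))\<^sup>2 + (norm (b n))\<^sup>2)"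
      using sum_squares_bound[of "norm (a n)" "norm (b n)"] by (simp add: power2_sum)
    finally show ?thesis by simp
  qed
qed

lemma H2_lin_sums:
  assumes "F \<in> H2" "G \<in> H2" "z \<in> unit_disc"
  shows "(\<lambda>n. (\<alpha> * maclaurin_coeff F n + \<beta> * maclaurin_coeff G n) * z ^ n) sums (\<alpha> * F z + \<beta> * G z)"
  using sums_add[OF sums_mult[OF H2_sums[OF assms(1,3)], of \<alpha>] sums_mult[OF H2_sums[OF assms(2,3)], of \<beta>]]
  by (simp add: algebra_simps)

lemma H2_lin:
  assumes "F \<in> H2" "G \<in> H2"
  shows "(\<lambda>z. \<alpha> * F z + \<beta> * G z) \<in> H2"
  by (rule H2I[OF H2_lin_sums[OF assms]])
    (auto intro!: l2_add l2_scale H2_summable assms simp: H2_outside[OF assms(1)] H2_outside[OF assms(2)])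

lemma maclaurin_coeff_lin:
  assumes "F \<in> H2" "G \<in> H2"
  shows "maclaurin_coeff (\<lambda>z. \<alpha> * F z + \<beta> * G z)
    = (\<lambda>n. \<alpha> * maclaurin_coeff F n + \<beta> * maclaurin_coeff G n)"
  by (rule maclaurin_coeff_eqI[OF H2_lin_sums[OF assms]])

lemma norm_mult_less_1: "norm (w * z) < 1"
  if "w \<in> unit_disc" "z \<in> unit_disc" for w z :: complex
  using that mult_strict_mono'[of "norm w" 1 "norm z" 1] by (simp add: norm_mult)

section \<open>Szego kernels and the bilinear pairing\<close>

lemma szego_sums:
  assumes "w \<in> unit_disc" "z \<in> unit_disc"
  shows "(\<lambda>n. w ^ n * z ^ n) sums szego w z"
  using geometric_sums[OF norm_mult_less_1[OF assms]] assms
  by (simp add: szego_def power_mult_distrib)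

lemma szego_summable: "summable (\<lambda>n. (norm (w ^ n))\<^sup>2)" if "w \<in> unit_disc" for w :: complex
proof -
  have "norm ((norm w)\<^sup>2) < 1" using that by (simp add: abs_square_less_1)
  from summable_geometric[OF this] show ?thesis
    by (simp add: norm_power flip: power_mult) (simp add: mult.commute)
qed

lemma szego_H2: "w \<in> unit_disc \<Longrightarrow> szego w \<in> H2"
  by (rule H2I[OF szego_sums _ szego_summable]) (auto simp: szego_def)

lemma maclaurin_coeff_szego: "w \<in> unit_disc \<Longrightarrow> maclaurin_coeff (szego w) = (\<lambda>n. w ^ n)"
  by (rule maclaurin_coeff_eqI[OF szego_sums])

text \<open>Conjugating the series of \<open>F\<close> at \<open>cnj z\<close> termwise leaves
  powers of \<open>z\<close> with conjugated coefficients.\<close>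

lemma hardy_J_sums:
  assumes "F \<in> H2" "z \<in> unit_disc"
  shows "(\<lambda>n. cnj (maclaurin_coeff F n) * z ^ n) sums hardy_J F z"
proof -
  have "cnj z \<in> unit_disc" using assms by simp
  then have "(\<lambda>n. cnj (maclaurin_coeff F n * cnj z ^ n)) sums cnj (F (cnj z))"
    using H2_sums[OF assms(1)] by (subst sums_cnj)
  then show ?thesis by (simp add: hardy_J_def)
qed

lemma hardy_J_H2: "F \<in> H2 \<Longrightarrow> hardy_J F \<in> H2"
  by (rule H2I[OF hardy_J_sums]) (auto simp: hardy_J_def H2_outside H2_summable)

lemma maclaurin_coeff_hardy_J:
  "F \<in> H2 \<Longrightarrow> maclaurin_coeff (hardy_J F) = (\<lambda>n. cnj (maclaurin_coeff F n))"
  by (rule maclaurin_coeff_eqI[OF hardy_J_sums])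

lemma hardy_inner_hardy_J:
  "F \<in> H2 \<Longrightarrow> G \<in> H2 \<Longrightarrow> hardy_inner F (hardy_J G) = (\<Sum>n. maclaurin_coeff F n * maclaurin_coeff G n)"
  by (simp add: hardy_inner_def maclaurin_coeff_hardy_J)

text \<open>In the bilinear pairing \<open>\<langle>F, J G\<rangle>\<close> the reproducing kernels carry no complex conjugate.\<close>

lemma szego_reproducing:
  "F \<in> H2 \<Longrightarrow> w \<in> unit_disc \<Longrightarrow> hardy_inner F (hardy_J (szego w)) = F w"
  using H2_sums[of F w]
  by (simp add: hardy_inner_hardy_J szego_H2 maclaurin_coeff_szego sums_iff)

lemma hardy_pairing_bound:
  assumes "F \<in> H2" "G \<in> H2"
  shows "norm (hardy_inner F (hardy_J G)) \<le> H2_norm F * H2_norm G"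
  unfolding hardy_inner_hardy_J[OF assms] H2_norm_def
  by (intro l2_Cauchy_Schwarz H2_summable assms)

lemma hardy_pairing_commute:
  "F \<in> H2 \<Longrightarrow> G \<in> H2 \<Longrightarrow> hardy_inner F (hardy_J G) = hardy_inner G (hardy_J F)"
  by (simp add: hardy_inner_hardy_J mult.commute)

lemma hardy_pairing_lin:
  assumes "F \<in> H2" "G \<in> H2" "K \<in> H2"
  shows "hardy_inner K (hardy_J (\<lambda>z. \<alpha> * F z + \<beta> * G z))
    = \<alpha> * hardy_inner K (hardy_J F) + \<beta> * hardy_inner K (hardy_J G)"
proof -
  note s = l2_summable_mult[OF H2_summable H2_summable]
  show ?thesis
    using suminf_add[OF summable_mult[OF s[OF assms(3,1)], of \<alpha>] summable_mult[OF s[OF assms(3,2)], of \<beta>]]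
      suminf_mult[OF s[OF assms(3,1)], of \<alpha>] suminf_mult[OF s[OF assms(3,2)], of \<beta>]
    by (simp add: hardy_inner_hardy_J H2_lin assms maclaurin_coeff_lin algebra_simps)
qed

text \<open>Taylor polynomials converge to \<open>F\<close> in norm, since the squared norm of the
  remainder is the tail of a convergent series; a bounded linear functional can therefore be applied
  term by term.\<close>

lemma H2_functional_expansion:
  assumes lin: "\<And>F G \<alpha> \<beta>. F \<in> H2 \<Longrightarrow> G \<in> H2 \<Longrightarrow>
      L (\<lambda>z. \<alpha> * F z + \<beta> * G z) = \<alpha> * L F + \<beta> * L G"
    and bnd: "\<And>F. F \<in> H2 \<Longrightarrow> norm (L F) \<le> M * H2_norm F"
    and F: "F \<in> H2"
  shows "(\<lambda>n. maclaurin_coeff F n * L (\<lambda>z. if z \<in> unit_disc then z ^ n else 0)) sums L F"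
proof -
  define e where "e n = (\<lambda>z::complex. if z \<in> unit_disc then z ^ n else 0)" for n
  define a where "a = maclaurin_coeff F"
  define R where "R N = (\<lambda>z. if z \<in> unit_disc then F z - (\<Sum>n<N. a n * z ^ n) else 0)" for N
  note sq = H2_summable[OF F, folded a_def]
  have R_sums: "(\<lambda>n. (if n < N then 0 else a n) * z ^ n) sums R N z" if "z \<in> unit_disc" for N z
  proof -
    have "(\<lambda>n. a n * z ^ n - (if n \<in> {..<N} then a n * z ^ n else 0)) sums (F z - (\<Sum>n<N. a n * z ^ n))"
      using H2_sums[OF F that] by (intro sums_diff sums_If_finite_set) (auto simp: a_def)
    moreover have "a n * z ^ n - (if n \<in> {..<N} then a n * z ^ n else 0) = (if n < N then 0 else a n) * z ^ n" for n
      by auto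
    ultimately show ?thesis using that by (simp add: R_def)
  qed
  have e_sums: "(\<lambda>k. (if k = n then 1 else 0) * z ^ k) sums e n z" if "z \<in> unit_disc" for n z
    using that sums_single[of n "\<lambda>k. z ^ k"] by (simp add: e_def if_distrib[of "\<lambda>x. x * _"] cong: if_cong)
  have e_H2: "e n \<in> H2" for n
  proof (rule H2I[OF e_sums])
    show "summable (\<lambda>k. (norm (if k = n then 1 else 0 :: complex))\<^sup>2)"
      by (rule summable_finite[of "{n}"]) auto
  qed (auto simp: e_def)
  have R_sq: "summable (\<lambda>n. (norm (if n < N then 0 else a n))\<^sup>2)" for N
    by (rule summable_comparison_test'[OF sq, where N = N]) auto
  have R_H2: "R N \<in> H2" for N
    by (rule H2I[OF R_sums _ R_sq]) (auto simp: R_def)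
  \<comment> \<open>Removing one Taylor term at a time needs linearity for two summands only; the
    differences telescope in \<open>partial\<close>.\<close>
  have R_step: "L (R N) = L (R (Suc N)) + a N * L (e N)" for N
  proof -
    have "L (R N) = L (\<lambda>z. 1 * R (Suc N) z + a N * e N z)"
      by (rule arg_cong[of _ _ L]) (auto simp: R_def e_def)
    also have "\<dots> = L (R (Suc N)) + a N * L (e N)"
      using lin[OF R_H2[of "Suc N"] e_H2[of N], of 1 "a N"] by simp
    finally show ?thesis .
  qed
  \<comment> \<open>Equality holds on the whole plane because \<open>F\<close> vanishes off the
    disc.\<close>
  have "R 0 = F" using H2_outside[OF F] by (auto simp: R_def)
  then have partial: "(\<Sum>n<N. a n * L (e n)) = L F - L (R N)" for N
  proof (induction N)
    case (Suc N)
    then show ?case using R_step[of N] by simp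
  qed simp
  have R_norm: "H2_norm (R N) = sqrt (\<Sum>n. (norm (a (n + N)))\<^sup>2)" for N
  proof -
    have "(\<Sum>n. (norm (if n < N then 0 else a n))\<^sup>2) = (\<Sum>n. (norm (a (n + N)))\<^sup>2)"
      using suminf_split_initial_segment[OF R_sq[of N], of N] by simp
    moreover have "maclaurin_coeff (R N) = (\<lambda>n. if n < N then 0 else a n)"
      by (rule maclaurin_coeff_eqI[OF R_sums])
    ultimately show ?thesis
      by (simp add: H2_norm_def)
  qed
  have "(\<lambda>N. \<Sum>n. (norm (a (n + N)))\<^sup>2) \<longlonglongrightarrow> 0"
    using suminf_exist_split2[OF sq] by simp
  from tendsto_mult[OF tendsto_const tendsto_real_sqrt[OF this], of M]
  have "(\<lambda>N. M * H2_norm (R N)) \<longlonglongrightarrow> 0"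
    unfolding R_norm by simp
  then have "(\<lambda>N. L (R N)) \<longlonglongrightarrow> 0"
    by (rule Lim_null_comparison[OF always_eventually[OF allI[OF bnd[OF R_H2]]]])
  from tendsto_diff[OF tendsto_const this, of "L F"]
  have "(\<lambda>N. L F - L (R N)) \<longlonglongrightarrow> L F - 0" .
  then have "(\<lambda>n. a n * L (e n)) sums L F"
    unfolding sums_def partial by simp
  then show ?thesis
    unfolding a_def e_def .
qed

text \<open>The Szego kernels span a dense subspace: on them the functional is the power series whose
  coefficients are its values on the monomials.\<close>

lemma H2_functional_eq_0:
  assumes lin: "\<And>F G \<alpha> \<beta>. F \<in> H2 \<Longrightarrow> G \<in> H2 \<Longrightarrow>
      L (\<lambda>z. \<alpha> * F z + \<beta> * G z) = \<alpha> * L F + \<beta> * L G"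
    and bnd: "\<And>F. F \<in> H2 \<Longrightarrow> norm (L F) \<le> M * H2_norm F"
    and ker: "\<And>w. w \<in> unit_disc \<Longrightarrow> L (szego w) = 0"
    and F: "F \<in> H2"
  shows "L F = 0"
proof -
  let ?e = "\<lambda>n z. if z \<in> unit_disc then z ^ n else 0 :: complex"
  have expansion: "(\<lambda>n. maclaurin_coeff G n * L (?e n)) sums L G" if "G \<in> H2" for G
    using H2_functional_expansion[where L = L and M = M and F = G] lin bnd that by blast
  have 1: "(\<lambda>n. L (?e n) * w ^ n) sums (\<lambda>_. 0) w" if "w \<in> unit_disc" for w
    using expansion[OF szego_H2[OF that]] ker[OF that] maclaurin_coeff_szego[OF that]
    by (simp add: mult.commute)
  \<comment> \<open>The coefficients of the zero function are computed twice: as the values of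
    \<open>L\<close> on the monomials, and as zeros.\<close>
  have "(\<lambda>n. L (?e n)) = (\<lambda>_. 0)"
    using maclaurin_coeff_eqI[OF 1] maclaurin_coeff_eqI[of "\<lambda>_. 0" "\<lambda>_. 0"] by simp
  then have "L (?e n) = 0" for n by metis
  then have "(\<lambda>n. 0) sums L F" using expansion[OF F] by simp
  then show ?thesis by (simp add: sums_iff)
qed

section \<open>Parseval's identity\<close>

text \<open>For \<open>k \<noteq> 0\<close> the antiderivative \<open>exp (c * t) / c\<close> agrees
  at both ends because \<open>exp c = 1\<close>. The interval \<open>{0..1}\<close> is the parameter
  interval of \<open>circlepath\<close>.\<close>

lemma exp_has_integral_circle:
  "((\<lambda>t. exp (2 * of_real pi * \<i> * of_int k * of_real t)) has_integral (if k = 0 then 1 else 0)) {0..1}"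
proof (cases "k = 0")
  case True
  then show ?thesis using has_integral_const_real[of "1::complex" 0 1] by simp
next
  case False
  define c where "c = 2 * of_real pi * \<i> * of_int k"
  have c: "c \<noteq> 0" using False by (simp add: c_def)
  have "((\<lambda>t. exp (c * of_real t)) has_integral exp (c * of_real 1) / c - exp (c * of_real 0) / c) {0..1}"
  proof (rule fundamental_theorem_of_calculus)
    fix t :: real
    have "((\<lambda>z. exp (c * z) / c) has_field_derivative exp (c * of_real t)) (at (of_real t))"
      using c by (auto intro!: derivative_eq_intros)
    then show "((\<lambda>t. exp (c * of_real t) / c) has_vector_derivative exp (c * of_real t)) (at t within {0..1})"
      by (rule has_vector_derivative_real_field)
  qed simp
  moreover have "exp c = 1"
    using exp_integer_2pi[of "of_int k"] by (simp add: c_def mult_ac)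
  ultimately show ?thesis using False by (simp add: c_def)
qed

text \<open>For Taylor partial sums the squared modulus is a double sum whose off-diagonal terms
  integrate to 0. Absolute convergence on the circle bounds the partial sums uniformly, and
  dominated convergence carries the identity over to \<open>F\<close>.\<close>

lemma Parseval_circle:
  assumes F: "F holomorphic_on unit_disc" and r: "0 < r" "r < 1"
  shows "(\<lambda>n. (norm (maclaurin_coeff F n))\<^sup>2 * r ^ (2 * n)) sums
           integral {0..1} (\<lambda>t. (norm (F (circlepath 0 r t)))\<^sup>2)"
proof -
  define a where "a = maclaurin_coeff F"
  define S where "S N t = (\<Sum>n<N. a n * circlepath 0 r t ^ n)" for N t
  have circ: "circlepath 0 r t = of_real r * exp (2 * of_real pi * \<i> * of_real t)" for t
    by (simp add: circlepath)
  have norm_circ: "norm (circlepath 0 r t) = r" for t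
    using r by (simp add: circ norm_mult)
  have S_integral: "((\<lambda>t. (norm (S N t))\<^sup>2) has_integral (\<Sum>n<N. (norm (a n))\<^sup>2 * r ^ (2 * n))) {0..1}" for N
  proof -
    let ?e = "\<lambda>k t. exp (2 * of_real pi * \<i> * of_int k * of_real t)"
    have "((\<lambda>t. \<Sum>m<N. \<Sum>n<N. (a m * cnj (a n) * of_real (r ^ (m + n))) * ?e (int m - int n) t) has_integral
        (\<Sum>m<N. \<Sum>n<N. (a m * cnj (a n) * of_real (r ^ (m + n))) * (if int m - int n = 0 then 1 else 0))) {0..1}"
      by (intro has_integral_sum has_integral_mult_right exp_has_integral_circle) auto
    moreover have "(\<Sum>m<N. \<Sum>n<N. (a m * cnj (a n) * of_real (r ^ (m + n))) * ?e (int m - int n) t)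
        = of_real ((norm (S N t))\<^sup>2)" for t
    proof -
      have "(a m * cnj (a n) * of_real (r ^ (m + n))) * ?e (int m - int n) t
          = (a m * circlepath 0 r t ^ m) * cnj (a n * circlepath 0 r t ^ n)" for m n
        by (simp add: circ power_mult_distrib exp_cnj power_add exp_diff exp_minus divide_inverse algebra_simps flip: exp_of_nat_mult)
      then show ?thesis
        by (simp only: complex_norm_square S_def cnj_sum sum_product)
    qed
    moreover have "(\<Sum>m<N. \<Sum>n<N. (a m * cnj (a n) * of_real (r ^ (m + n))) * (if int m - int n = 0 then 1 else 0))
        = of_real (\<Sum>n<N. (norm (a n))\<^sup>2 * r ^ (2 * n))"
    proof -
      have "(\<Sum>n<N. (a m * cnj (a n) * of_real (r ^ (m + n))) * (if int m - int n = 0 then 1 else 0))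
          = of_real ((norm (a m))\<^sup>2 * r ^ (2 * m))" if "m < N" for m
      proof -
        have "(\<Sum>n<N. (a m * cnj (a n) * of_real (r ^ (m + n))) * (if int m - int n = 0 then 1 else 0))
          = (\<Sum>n<N. if n = m then a m * cnj (a m) * of_real (r ^ (m + m)) else 0)"
          by (intro sum.cong) auto
        then show ?thesis using that complex_norm_square[of "a m"] by (simp add: mult_2)
      qed
      then show ?thesis by simp
    qed
    ultimately have "((\<lambda>t. complex_of_real ((norm (S N t))\<^sup>2)) has_integral
        of_real (\<Sum>n<N. (norm (a n))\<^sup>2 * r ^ (2 * n))) {0..1}" by simp
    from has_integral_linear[OF this bounded_linear_Re] show ?thesis by (simp add: o_def)
  qed
  \<comment> \<open>The point \<open>(1 + r) / 2\<close> lies strictly between \<open>r\<close> and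
    1; convergence there forces absolute convergence at \<open>r\<close>.\<close>
  have "summable (\<lambda>n. a n * of_real ((1 + r) / 2) ^ n)"
    using sums_maclaurin[OF F, of "of_real ((1 + r) / 2)"] r unfolding a_def 
    by (auto simp: norm_divide sums_iff simp del: of_real_divide of_real_add)
  then have "summable (\<lambda>n. norm (a n * of_real r ^ n))"
    by (rule powser_insidea) (use r in \<open>simp del: of_real_divide of_real_add\<close>)
  then have sa: "summable (\<lambda>n. norm (a n) * r ^ n)"
    using r by (simp add: norm_mult norm_power)
  define K where "K = (\<Sum>n. norm (a n) * r ^ n)"
  have S_bound: "norm (S N t) \<le> K" for N t
  proof -
    have "norm (S N t) \<le> (\<Sum>n<N. norm (a n) * r ^ n)"
      unfolding S_def by (rule order_trans[OF norm_sum]) (simp add: norm_mult norm_power norm_circ)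
    also have "\<dots> \<le> K"
      unfolding K_def by (intro sum_le_suminf sa) (use r in auto)
    finally show ?thesis .
  qed
  have S_lim: "(\<lambda>N. S N t) \<longlonglongrightarrow> F (circlepath 0 r t)" for t
    using sums_maclaurin[OF F, of "circlepath 0 r t"] r norm_circ[of t]
    by (simp add: S_def sums_def a_def)
  have "(\<lambda>N. integral {0..1} (\<lambda>t. (norm (S N t))\<^sup>2)) \<longlonglongrightarrow>
      integral {0..1} (\<lambda>t. (norm (F (circlepath 0 r t)))\<^sup>2)"
  proof (rule dominated_convergence(2)[where h = "\<lambda>_. K\<^sup>2"])
    show "norm ((norm (S N t))\<^sup>2) \<le> K\<^sup>2" for N t
      using S_bound[of N t] by (simp add: power_mono)
    show "(\<lambda>N. (norm (S N t))\<^sup>2) \<longlonglongrightarrow> (norm (F (circlepath 0 r t)))\<^sup>2" for t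
      by (intro tendsto_intros S_lim)
  qed (use S_integral in \<open>auto simp: has_integral_integrable\<close>)
  then show ?thesis
    unfolding sums_def integral_unique[OF S_integral] a_def .
qed

text \<open>Each weighted mean is at most \<open>suminf p\<close>, and letting \<open>r\<close> tend
  to 1 recovers every partial sum. The factor \<open>r\<close> in front is the radius left over from
  arc length in \<open>hs_mean_eq\<close>.\<close>

lemma Abel_sup:
  fixes p I :: "_ \<Rightarrow> real"
  assumes p: "\<And>n. 0 \<le> p n"
    and I: "\<And>r. 0 < r \<Longrightarrow> r < 1 \<Longrightarrow> (\<lambda>n. p n * r ^ (2 * n)) sums I r"
  shows Abel_bdd_iff: "bdd_above ((\<lambda>r. r * I r) ` {0<..<1}) \<longleftrightarrow> summable p"
    and Abel_SUP: "summable p \<Longrightarrow> (SUP r\<in>{0<..<1}. r * I r) = suminf p"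
proof -
  have I_nonneg: "0 \<le> I r" if "0 < r" "r < 1" for r
    using sums_le[OF _ sums_zero I[OF that]] p that by simp
  have upper: "r * I r \<le> suminf p" if "summable p" "0 < r" "r < 1" for r
  proof -
    have "I r \<le> suminf p"
      by (rule sums_le[OF _ I[OF that(2,3)] summable_sums[OF that(1)]])
        (use p that in \<open>auto intro!: mult_left_le power_le_one\<close>)
    moreover have "r * I r \<le> I r"
      using mult_right_mono[of r 1 "I r"] that I_nonneg by simp
    ultimately show ?thesis by simp
  qed
  \<comment> \<open>A finite partial sum is continuous in \<open>r\<close>, so the bound
    \<open>K\<close> survives the limit from the left at 1.\<close>
  have lower: "(\<Sum>n<N. p n) \<le> K" if K: "\<And>r. 0 < r \<Longrightarrow> r < 1 \<Longrightarrow> r * I r \<le> K" for K N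
  proof (rule tendsto_upperbound)
    show "((\<lambda>r::real. r * (\<Sum>n<N. p n * r ^ (2 * n))) \<longlongrightarrow> (\<Sum>n<N. p n)) (at_left 1)"
    proof -
      have "((\<lambda>r::real. r * (\<Sum>n<N. p n * r ^ (2 * n))) \<longlongrightarrow> 1 * (\<Sum>n<N. p n * 1 ^ (2 * n))) (at_left 1)"
        by (intro tendsto_intros)
      then show ?thesis by simp
    qed
    have "r * (\<Sum>n<N. p n * r ^ (2 * n)) \<le> K" if r: "0 < r" "r < 1" for r
    proof -
      have "(\<Sum>n<N. p n * r ^ (2 * n)) \<le> I r"
        using sum_le_suminf[OF sums_summable[OF I[OF r]], of "{..<N}"] p r
        by (simp add: sums_unique[OF I[OF r]])
      then show ?thesis using K[OF r] mult_left_mono r by (meson less_imp_le order_trans)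
    qed
    then show "\<forall>\<^sub>F r in at_left 1. r * (\<Sum>n<N. p n * r ^ (2 * n)) \<le> K"
      by (auto simp: eventually_at_left_field intro!: exI[of _ 0])
  qed simp
  show "bdd_above ((\<lambda>r. r * I r) ` {0<..<1}) \<longleftrightarrow> summable p"
  proof
    assume "bdd_above ((\<lambda>r. r * I r) ` {0<..<1})"
    then obtain K where "\<forall>r\<in>{0<..<1}. r * I r \<le> K" by (auto simp: bdd_above_def)
    then have "(\<Sum>n<N. p n) \<le> K" for N by (intro lower) auto
    then show "summable p" by (intro summableI_nonneg_bounded[of p K] p)
  qed (auto intro!: bdd_aboveI upper)
  assume s: "summable p"
  have bdd: "bdd_above ((\<lambda>r. r * I r) ` {0<..<1})" using upper[OF s] by (auto intro!: bdd_aboveI)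
  show "(SUP r\<in>{0<..<1}. r * I r) = suminf p"
  proof (rule antisym)
    show "(SUP r\<in>{0<..<1}. r * I r) \<le> suminf p" using upper[OF s] by (intro cSUP_least) auto
    show "suminf p \<le> (SUP r\<in>{0<..<1}. r * I r)"
      by (intro suminf_le_const s lower cSUP_upper bdd) auto
  qed
qed

section \<open>The Hardy--Smirnov space of a Riemann map\<close>

locale hardy_smirnov_space =
  fixes \<Omega> :: "complex set" and \<tau> s :: "complex \<Rightarrow> complex"
  assumes riemann: "riemann_map \<Omega> \<tau>"
    and s_holomorphic: "s holomorphic_on unit_disc"
    and s_square: "z \<in> unit_disc \<Longrightarrow> (s z)\<^sup>2 = deriv \<tau> z"
begin

abbreviation "H \<equiv> hardy_smirnov \<Omega> \<tau>"
abbreviation "V \<equiv> hs_V \<tau> s"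
abbreviation "J \<equiv> hs_J \<Omega> \<tau> s"
abbreviation "ip \<equiv> hs_inner \<tau> s"
abbreviation "\<sigma> \<equiv> inv_into unit_disc \<tau>"

definition V_inv :: "(complex \<Rightarrow> complex) \<Rightarrow> complex \<Rightarrow> complex" where
  "V_inv G = (\<lambda>w. if w \<in> \<Omega> then G (\<sigma> w) / s (\<sigma> w) else 0)"

text \<open>The function \<open>E\<^sub>w\<close> of the overview. Dividing by
  \<open>s (\<sigma> w)\<close> cancels the factor that \<open>V\<close> attaches to the value at
  \<open>w\<close>, so that point evaluation comes out without a weight.\<close>

definition kernel :: "complex \<Rightarrow> complex \<Rightarrow> complex" where
  "kernel w = V_inv (\<lambda>z. szego (\<sigma> w) z / s (\<sigma> w))"

lemma \<tau>_holomorphic: "\<tau> holomorphic_on unit_disc"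
  and \<sigma>_holomorphic: "\<sigma> holomorphic_on \<Omega>"
  and \<tau>_inj: "inj_on \<tau> unit_disc"
  and \<tau>_image: "\<tau> ` unit_disc = \<Omega>"
  using riemann by (auto simp: riemann_map_def bij_betw_def)

lemma \<tau>_in: "z \<in> unit_disc \<Longrightarrow> \<tau> z \<in> \<Omega>"
  using \<tau>_image by blast

lemma \<sigma>_in: "w \<in> \<Omega> \<Longrightarrow> \<sigma> w \<in> unit_disc"
  using \<tau>_image by (metis inv_into_into)

lemma \<tau>_\<sigma>: "w \<in> \<Omega> \<Longrightarrow> \<tau> (\<sigma> w) = w"
  using \<tau>_image by (metis f_inv_into_f)

lemma \<sigma>_\<tau>: "z \<in> unit_disc \<Longrightarrow> \<sigma> (\<tau> z) = z"
  using \<tau>_inj by (rule inv_into_f_f)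

text \<open>An injective holomorphic map has nonvanishing derivative.\<close>

lemma s_nonzero: "z \<in> unit_disc \<Longrightarrow> s z \<noteq> 0"
  using holomorphic_injective_imp_regular[OF \<tau>_holomorphic open_ball \<tau>_inj, of z] s_square[of z]
  by auto

section \<open>The isometry \<open>V\<close> between the two Hardy spaces\<close>

lemma hs_mean_eq:
  assumes r: "0 < r" "r < 1"
  shows "hs_mean \<tau> f r = r * integral {0..1} (\<lambda>t. (norm (V f (circlepath 0 r t)))\<^sup>2)"
proof -
  have in_disc: "circlepath 0 r t \<in> unit_disc" for t
    using r by (simp add: circlepath norm_mult)
  have "vector_derivative (\<tau> \<circ> circlepath 0 r) (at t within {0..1})
      = 2 * of_real pi * \<i> * of_real r * exp (2 * of_real pi * \<i> * of_real t) * deriv \<tau> (circlepath 0 r t)"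
    if "t \<in> {0..1}" for t
    using that holomorphic_derivI[OF \<tau>_holomorphic open_ball in_disc[of t]]
      has_vector_derivative_circlepath[of 0 r t UNIV]
    by (intro vector_derivative_at_within_ivl field_vector_diff_chain_at) auto
  \<comment> \<open>The speed of the image curve is \<open>2 * pi * r\<close> times the modulus of
    \<open>deriv \<tau>\<close>, which is the squared modulus of \<open>s\<close>; this is the
    weight that \<open>V\<close> absorbs.\<close>
  then have "norm (vector_derivative (\<tau> \<circ> circlepath 0 r) (at t within {0..1}))
      = 2 * pi * r * (norm (s (circlepath 0 r t)))\<^sup>2" if "t \<in> {0..1}" for t
    using that r by (simp add: norm_mult norm_power flip: s_square[OF in_disc])
  then have "arclength_integral (\<tau> \<circ> circlepath 0 r) (\<lambda>w. (norm (f w))\<^sup>2)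
      = integral {0..1} (\<lambda>t. 2 * pi * r * (norm (V f (circlepath 0 r t)))\<^sup>2)"
    unfolding arclength_integral_def using in_disc
    by (intro integral_cong) (simp add: hs_V_def norm_mult power_mult_distrib)
  then show ?thesis by (simp add: hs_mean_def)
qed

lemma V_holomorphic: "f holomorphic_on \<Omega> \<Longrightarrow> V f holomorphic_on unit_disc"
proof -
  assume "f holomorphic_on \<Omega>"
  then have "(f \<circ> \<tau>) holomorphic_on unit_disc"
    using \<tau>_holomorphic \<tau>_image by (intro holomorphic_on_compose_gen[where t = \<Omega>]) auto
  then have "(\<lambda>z. (f \<circ> \<tau>) z * s z) holomorphic_on unit_disc"
    by (intro holomorphic_on_mult s_holomorphic)
  then show ?thesis
    by (rule holomorphic_transform) (simp add: hs_V_def)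
qed

text \<open>The means of \<open>f\<close> are \<open>r\<close> times the circle means of
  \<open>V f\<close>, so \<open>Parseval_circle\<close> feeds \<open>Abel_sup\<close> with the
  squared moduli of the coefficients as \<open>p\<close>. This makes \<open>V\<close>
  isometric.\<close>

lemma
  assumes "f holomorphic_on \<Omega>"
  shows bdd_above_hs_mean: "bdd_above (hs_mean \<tau> f ` {0<..<1}) \<longleftrightarrow>
      summable (\<lambda>n. (norm (maclaurin_coeff (V f) n))\<^sup>2)"
    and hs_norm_V: "summable (\<lambda>n. (norm (maclaurin_coeff (V f) n))\<^sup>2) \<Longrightarrow> hs_norm \<tau> f = H2_norm (V f)"
proof -
  let ?I = "\<lambda>r. integral {0..1} (\<lambda>t. (norm (V f (circlepath 0 r t)))\<^sup>2)"
  have img: "hs_mean \<tau> f ` {0<..<1} = (\<lambda>r. r * ?I r) ` {0<..<1}"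
    by (intro image_cong) (simp_all add: hs_mean_eq)
  note Parseval = Parseval_circle[OF V_holomorphic[OF assms]]
  show "bdd_above (hs_mean \<tau> f ` {0<..<1}) \<longleftrightarrow> summable (\<lambda>n. (norm (maclaurin_coeff (V f) n))\<^sup>2)"
    unfolding img by (rule Abel_bdd_iff[OF _ Parseval]) auto
  assume "summable (\<lambda>n. (norm (maclaurin_coeff (V f) n))\<^sup>2)"
  then show "hs_norm \<tau> f = H2_norm (V f)"
    unfolding hs_norm_def H2_norm_def img by (subst Abel_SUP[OF _ Parseval]) auto
qed

lemma H_iff: "f \<in> H \<longleftrightarrow> f holomorphic_on \<Omega> \<and> (\<forall>w. w \<notin> \<Omega> \<longrightarrow> f w = 0) \<and> V f \<in> H2"
  using V_holomorphic[of f] bdd_above_hs_mean[of f]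
  by (auto simp: hardy_smirnov_def H2_def hs_V_def)

lemma V_in: "f \<in> H \<Longrightarrow> V f \<in> H2"
  by (simp add: H_iff)

lemma H_outside: "f \<in> H \<Longrightarrow> w \<notin> \<Omega> \<Longrightarrow> f w = 0"
  by (simp add: H_iff)

lemma norm_V: "f \<in> H \<Longrightarrow> hs_norm \<tau> f = H2_norm (V f)"
  by (simp add: H_iff hs_norm_V H2_summable)

lemma V_V_inv: "G \<in> H2 \<Longrightarrow> V (V_inv G) = G"
  by (auto simp: hs_V_def V_inv_def \<tau>_in \<sigma>_\<tau> s_nonzero H2_outside simp del: mem_ball_0)

lemma V_inv_V: "f \<in> H \<Longrightarrow> V_inv (V f) = f"
proof
  fix w assume f: "f \<in> H"
  show "V_inv (V f) w = f w"
  proof (cases "w \<in> \<Omega>")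
    case True
    then show ?thesis
      using \<sigma>_in[OF True] s_nonzero[OF \<sigma>_in[OF True]] by (simp add: hs_V_def V_inv_def \<tau>_\<sigma>)
  qed (simp add: V_inv_def H_outside f)
qed

lemma V_inv_in: "G \<in> H2 \<Longrightarrow> V_inv G \<in> H"
proof -
  assume G: "G \<in> H2"
  have "((\<lambda>z. G z / s z) \<circ> \<sigma>) holomorphic_on \<Omega>"
    using H2_holomorphic[OF G] s_holomorphic s_nonzero \<sigma>_holomorphic \<sigma>_in
    by (intro holomorphic_on_compose_gen[where t = unit_disc] holomorphic_on_divide) auto
  then have "V_inv G holomorphic_on \<Omega>"
    by (rule holomorphic_transform) (simp add: V_inv_def)
  then show ?thesis
    using G by (simp add: H_iff V_V_inv) (simp add: V_inv_def)
qed

lemma V_lin: "V (\<lambda>w. \<alpha> * f w + \<beta> * g w) = (\<lambda>z. \<alpha> * V f z + \<beta> * V g z)"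
  by (auto simp: hs_V_def algebra_simps)

lemma V_inv_lin: "V_inv (\<lambda>z. \<alpha> * F z + \<beta> * G z) = (\<lambda>w. \<alpha> * V_inv F w + \<beta> * V_inv G w)"
  by (auto simp: V_inv_def add_divide_distrib)

lemma inj_V: "inj_on V H"
  by (metis V_inv_V inj_onI)

lemma H_lin: "f \<in> H \<Longrightarrow> g \<in> H \<Longrightarrow> (\<lambda>w. \<alpha> * f w + \<beta> * g w) \<in> H"
  using V_inv_in[OF H2_lin[OF V_in V_in]] by (simp add: V_inv_lin V_inv_V)

section \<open>The conjugation \<open>J\<close>\<close>

lemma J_eq: "f \<in> H \<Longrightarrow> J f = V_inv (hardy_J (V f))"
  unfolding hs_J_def by (intro inv_into_f_eq inj_V V_inv_in V_V_inv hardy_J_H2 V_in)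

lemma J_in: "f \<in> H \<Longrightarrow> J f \<in> H"
  by (simp add: J_eq V_inv_in hardy_J_H2 V_in)

lemma V_J: "f \<in> H \<Longrightarrow> V (J f) = hardy_J (V f)"
  by (simp add: J_eq V_V_inv hardy_J_H2 V_in)

lemma J_J: "f \<in> H \<Longrightarrow> J (J f) = f"
proof -
  assume f: "f \<in> H"
  have "V (J (J f)) = V f"
    by (simp add: V_J J_in f) (simp add: hardy_J_def)
  then show ?thesis using f by (metis J_in V_inv_V)
qed

lemma ip_J: "f \<in> H \<Longrightarrow> ip f (J g) = hardy_inner (V f) (hardy_J (V g))" if "g \<in> H"
  by (simp add: hs_inner_def V_J that)

lemma ip_J_commute: "f \<in> H \<Longrightarrow> g \<in> H \<Longrightarrow> ip f (J g) = ip g (J f)"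
  by (simp add: ip_J hardy_pairing_commute V_in)

lemma J_conjugation: "conjugation_on H ip J"
  unfolding conjugation_on_def
proof (intro conjI ballI allI)
  fix f g \<alpha> \<beta> assume f: "f \<in> H" and g: "g \<in> H"
  \<comment> \<open>Symmetry of the bilinear pairing, applied to \<open>J f\<close> and
    \<open>g\<close>, followed by \<open>J (J f) = f\<close>.\<close>
  show "ip (J f) (J g) = ip g f"
    using ip_J_commute[OF J_in[OF f] g] J_J[OF f] by simp
  show "J (\<lambda>w. \<alpha> * f w + \<beta> * g w) = (\<lambda>w. cnj \<alpha> * J f w + cnj \<beta> * J g w)"
    by (simp add: J_eq H_lin f g V_lin flip: V_inv_lin) (simp add: hardy_J_def)
qed (auto simp: J_in J_J)

section \<open>Reproducing kernels on \<Omega> and adjoints\<close>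

lemma kernel_in_V:
  assumes "w \<in> \<Omega>"
  shows kernel_in: "kernel w \<in> H"
    and V_kernel: "V (kernel w) = (\<lambda>z. szego (\<sigma> w) z / s (\<sigma> w))"
proof -
  have "(\<lambda>z. szego (\<sigma> w) z / s (\<sigma> w)) \<in> H2"
    using H2_lin[OF szego_H2 szego_H2, OF \<sigma>_in \<sigma>_in, OF assms assms, of "1 / s (\<sigma> w)" 0] by simp
  then show "kernel w \<in> H" "V (kernel w) = (\<lambda>z. szego (\<sigma> w) z / s (\<sigma> w))"
    by (simp_all add: kernel_def V_inv_in V_V_inv)
qed

lemma kernel_reproducing:
  assumes f: "f \<in> H" and w: "w \<in> \<Omega>"
  shows "ip f (J (kernel w)) = f w"
proof -
  have z: "\<sigma> w \<in> unit_disc" by (rule \<sigma>_in[OF w])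
  have "ip f (J (kernel w)) = hardy_inner (V f) (hardy_J (\<lambda>z. szego (\<sigma> w) z / s (\<sigma> w)))"
    by (simp add: ip_J kernel_in V_kernel f w)
  also have "\<dots> = V f (\<sigma> w) / s (\<sigma> w)"
    using hardy_pairing_lin[OF szego_H2[OF z] szego_H2[OF z] V_in[OF f], of "1 / s (\<sigma> w)" 0]
    using szego_reproducing[OF V_in[OF f] z] by simp
  also have "\<dots> = f w"
    using z by (simp add: hs_V_def \<tau>_\<sigma> w s_nonzero del: mem_ball_0)
  finally show ?thesis .
qed

text \<open>Testing against \<open>kernel w\<close> returns \<open>J h w\<close>, so the inner
  products determine \<open>J h\<close> and hence \<open>h\<close>. This is the uniqueness behind
  the definite description in \<open>adjoint_on\<close>.\<close>

lemma ip_right_eqI: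
  assumes h: "h \<in> H" "h' \<in> H" and eq: "\<And>f. f \<in> H \<Longrightarrow> ip f h = ip f h'"
  shows "h = h'"
proof -
  have "J h w = J h' w" for w
  proof (cases "w \<in> \<Omega>")
    case True
    have "J k w = ip (kernel w) k" if "k \<in> H" for k
      using kernel_reproducing[OF J_in[OF that] True] ip_J_commute[OF J_in[OF that] kernel_in[OF True]]
      by (simp add: J_J that)
    then show ?thesis using h eq kernel_in[OF True] by simp
  qed (simp add: H_outside J_in h)
  then have "J h = J h'" by blast
  then show ?thesis using J_J h by metis
qed

lemma adjoint_eqI:
  assumes "h \<in> H" "\<And>f. f \<in> H \<Longrightarrow> ip (T f) g = ip f h"
  shows "adjoint_on H ip T g = h"
  unfolding adjoint_on_def
  by (rule the_equality) (use assms in \<open>auto intro: ip_right_eqI\<close>)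

text \<open>By \<open>T_kernel\<close> the adjoint sends \<open>J (kernel w)\<close> to
  \<open>J (kernel (\<Phi> w))\<close>. Applying symmetry to \<open>kernel w\<close> and cancelling
  \<open>J\<close> gives one direction; density of the kernels and boundedness give the
  other.\<close>

lemma comp_op_kernel_iff:
  assumes self: "\<Phi> ` \<Omega> \<subseteq> \<Omega>"
  shows "comp_op_J_symmetric \<Omega> \<tau> s \<Phi> \<longleftrightarrow>
      comp_op_bounded \<Omega> \<tau> \<Phi> \<and> (\<forall>w\<in>\<Omega>. comp_op \<Omega> \<Phi> (kernel w) = kernel (\<Phi> w))"
proof (cases "comp_op_bounded \<Omega> \<tau> \<Phi>")
  case False
  then show ?thesis
    by (simp add: comp_op_J_symmetric_def C_symmetric_on_def comp_op_bounded_def)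
next
  case True
  define T where "T = comp_op \<Omega> \<Phi>"
  have T_in: "T f \<in> H" if "f \<in> H" for f
    using True that by (auto simp: comp_op_bounded_def bounded_operator_on_def T_def)
  obtain M where M: "\<forall>f\<in>H. hs_norm \<tau> (T f) \<le> M * hs_norm \<tau> f"
    using True by (auto simp: comp_op_bounded_def bounded_operator_on_def T_def)
  have \<Phi>_in: "\<Phi> w \<in> \<Omega>" if "w \<in> \<Omega>" for w using self that by auto
  have T_lin: "T (\<lambda>w. \<alpha> * f w + \<beta> * g w) = (\<lambda>w. \<alpha> * T f w + \<beta> * T g w)" for f g \<alpha> \<beta>
    by (auto simp: T_def comp_op_def)
  have T_kernel: "ip (T f) (J (kernel w)) = ip f (J (kernel (\<Phi> w)))" if "f \<in> H" "w \<in> \<Omega>" for f w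
    using that by (simp add: kernel_reproducing T_in \<Phi>_in) (simp add: T_def comp_op_def)
  have "(\<forall>f\<in>H. J (T f) = adjoint_on H ip T (J f)) \<longleftrightarrow> (\<forall>w\<in>\<Omega>. T (kernel w) = kernel (\<Phi> w))"
  proof (intro iffI ballI)
    fix w assume sym: "\<forall>f\<in>H. J (T f) = adjoint_on H ip T (J f)" and w: "w \<in> \<Omega>"
    have "adjoint_on H ip T (J (kernel w)) = J (kernel (\<Phi> w))"
      by (rule adjoint_eqI) (simp_all add: J_in kernel_in \<Phi>_in w T_kernel)
    then have "J (T (kernel w)) = J (kernel (\<Phi> w))" using sym kernel_in[OF w] by simp
    then show "T (kernel w) = kernel (\<Phi> w)"
      using J_J T_in kernel_in \<Phi>_in w by metis
  next
    fix f assume ker: "\<forall>w\<in>\<Omega>. T (kernel w) = kernel (\<Phi> w)" and f: "f \<in> H"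
    have "ip (T g) (J f) = ip g (J (T f))" if g: "g \<in> H" for g
    proof -
      \<comment> \<open>For fixed \<open>g\<close>, \<open>L\<close> measures the failure of
        symmetry, moved to the disc through \<open>V_inv\<close> so that
        \<open>H2_functional_eq_0\<close> applies; \<open>L_V\<close> recovers the defect on
        \<open>H\<close>.\<close>
      define L where "L F = hardy_inner (V (T g)) (hardy_J F) - hardy_inner (V g) (hardy_J (V (T (V_inv F))))" for F
      have L_V: "L (V f) = ip (T g) (J f) - ip g (J (T f))" if "f \<in> H" for f
        using that g by (simp add: L_def ip_J T_in V_inv_V)
      have L_lin: "L (\<lambda>z. \<alpha> * F z + \<beta> * G z) = \<alpha> * L F + \<beta> * L G" if "F \<in> H2" "G \<in> H2" for F G \<alpha> \<beta>
        using that g by (simp add: L_def V_inv_lin T_lin V_lin hardy_pairing_lin V_in T_in V_inv_in algebra_simps)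
      have L_bound: "norm (L F) \<le> (H2_norm (V (T g)) + H2_norm (V g) * M) * H2_norm F" if F: "F \<in> H2" for F
      proof -
        have "norm (L F) \<le> H2_norm (V (T g)) * H2_norm F + H2_norm (V g) * H2_norm (V (T (V_inv F)))"
          unfolding L_def
          by (intro order_trans[OF norm_triangle_ineq4] add_mono hardy_pairing_bound V_in T_in V_inv_in g F)
        also have "H2_norm (V g) * H2_norm (V (T (V_inv F))) \<le> H2_norm (V g) * (M * H2_norm F)"
          using bspec[OF M V_inv_in[OF F]]
          by (intro mult_left_mono H2_norm_nonneg V_in g) (simp add: norm_V T_in V_inv_in V_V_inv F)
        finally show ?thesis by (simp add: algebra_simps)
      qed
      have "L (szego z) = 0" if z: "z \<in> unit_disc" for z
      proof -
        have w: "\<tau> z \<in> \<Omega>" by (rule \<tau>_in[OF z])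
        have "L (V (kernel (\<tau> z))) = 0"
          using ker w g T_kernel[OF g w] by (simp add: L_V kernel_in)
        \<comment> \<open>The Szego kernel is \<open>s z\<close> times the transported kernel at
          \<open>\<tau> z\<close>; the second term with coefficient 0 fits the two-term form of
          linearity.\<close>
        moreover have "L (szego z) = L (\<lambda>u. s z * V (kernel (\<tau> z)) u + 0 * V (kernel (\<tau> z)) u)"
          by (rule arg_cong[of _ _ L]) (simp add: V_kernel w \<sigma>_\<tau>[OF z] s_nonzero[OF z])
        moreover have "\<dots> = s z * L (V (kernel (\<tau> z)))"
          using L_lin[OF V_in V_in, OF kernel_in kernel_in, OF w w, of "s z" 0] by simp
        ultimately show ?thesis by simp
      qed
      then have "L (V f) = 0"
        using H2_functional_eq_0[where L = L and F = "V f", OF L_lin L_bound _ V_in[OF f]] by blast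
      then show ?thesis
        using L_V[OF f] by simp
    qed
    then show "J (T f) = adjoint_on H ip T (J f)"
      by (intro adjoint_eqI[symmetric] J_in T_in f)
  qed
  then show ?thesis
    using True J_conjugation
    by (simp add: comp_op_J_symmetric_def C_symmetric_on_def comp_op_bounded_def T_def)
qed

end

section \<open>Linear fractional Riemann maps\<close>

locale linear_fractional_hardy_smirnov =
  fixes \<Omega> :: "complex set" and \<tau> s :: "complex \<Rightarrow> complex" and a b c d :: complex
  assumes lfr: "linear_fractional_riemann_map \<Omega> \<tau> a b c d"
    and s_hol: "s holomorphic_on unit_disc"
    and s_sq: "z \<in> unit_disc \<Longrightarrow> (s z)\<^sup>2 = deriv \<tau> z"
begin

sublocale hardy_smirnov_space \<Omega> \<tau> s
  using lfr s_hol s_sq by unfold_locales (auto simp: linear_fractional_riemann_map_def)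

lemma det_nonzero: "a * d - b * c \<noteq> 0"
  and \<tau>_eq: "z \<in> unit_disc \<Longrightarrow> \<tau> z = (a * z + b) / (c * z + d)"
  using lfr by (auto simp: linear_fractional_riemann_map_def)

text \<open>Near a pole \<open>\<tau> u * (c * u + d) = a * u + b\<close>; continuity of
  \<open>\<tau>\<close> extends this to the pole, so numerator and denominator vanish together and
  the determinant is 0.\<close>

lemma denominator_nonzero:
  assumes z: "z \<in> unit_disc"
  shows "c * z + d \<noteq> 0"
proof
  assume pole: "c * z + d = 0"
  with det_nonzero have "c \<noteq> 0" by auto
  have "isCont \<tau> z"
    using holomorphic_on_imp_continuous_on[OF \<tau>_holomorphic] z continuous_on_eq_continuous_at[OF open_ball] by blast
  then have "((\<lambda>u. \<tau> u * (c * u + d) - (a * u + b)) \<longlongrightarrow> \<tau> z * (c * z + d) - (a * z + b)) (at z)"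
    unfolding isCont_def by (intro tendsto_intros)
  \<comment> \<open>The point \<open>z\<close> is excluded: division by zero yields 0 there, so
    clearing the denominator is only possible for \<open>u \<noteq> z\<close>.\<close>
  moreover have "\<forall>\<^sub>F u in at z. \<tau> u * (c * u + d) - (a * u + b) = 0"
  proof -
    have "\<forall>\<^sub>F u in at z. u \<in> unit_disc - {z}"
      using z by (intro eventually_at_in_open) auto
    then show ?thesis
    proof eventually_elim
      case (elim u)
      have "c * u + d = c * (u - z)" using pole by (simp add: algebra_simps add_eq_0_iff)
      then have "c * u + d \<noteq> 0" using elim \<open>c \<noteq> 0\<close> by simp
      then show ?case using elim by (simp add: \<tau>_eq)
    qed
  qed
  ultimately have "((\<lambda>u. 0) \<longlongrightarrow> \<tau> z * (c * z + d) - (a * z + b)) (at z)"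
    by (rule Lim_transform_eventually)
  then have "\<tau> z * (c * z + d) - (a * z + b) = 0"
    by (simp add: tendsto_const_iff)
  then have "a * z + b = 0" using pole by (auto simp: add_eq_0_iff)
  with pole have "b = - a * z" "d = - c * z" by (simp_all add: add_eq_0_iff)
  with det_nonzero show False by simp
qed

lemma deriv_\<tau>:
  assumes z: "z \<in> unit_disc"
  shows "deriv \<tau> z = (a * d - b * c) / (c * z + d)\<^sup>2"
proof -
  have "((\<lambda>z. (a * z + b) / (c * z + d)) has_field_derivative (a * d - b * c) / (c * z + d)\<^sup>2) (at z)"
    using denominator_nonzero[OF z]
    by (auto intro!: derivative_eq_intros simp: power2_eq_square algebra_simps)
  then have "(\<tau> has_field_derivative (a * d - b * c) / (c * z + d)\<^sup>2) (at z)"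
    by (rule has_field_derivative_transform_within_open[OF _ open_ball z]) (rule \<tau>_eq[symmetric])
  then show ?thesis by (rule DERIV_imp_deriv)
qed

text \<open>The branch \<open>s\<close> is a constant multiple of \<open>1 / (c * z + d)\<close>.\<close>

lemma s_mult:
  assumes "z \<in> unit_disc" "w \<in> unit_disc"
  shows "s z * (c * z + d) * (s w * (c * w + d)) = a * d - b * c"
proof -
  define h where "h z = s z * (c * z + d)" for z
  have sq: "(h z)\<^sup>2 = a * d - b * c" if "z \<in> unit_disc" for z
    using denominator_nonzero[OF that]
    by (simp add: h_def power_mult_distrib s_sq[OF that] deriv_\<tau>[OF that])
  \<comment> \<open>\<open>h\<close> takes at most two values, and a continuous function with finite
    range on the connected disc is constant.\<close>
  have "h z = csqrt (a * d - b * c) \<or> h z = - csqrt (a * d - b * c)" if "z \<in> unit_disc" for z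
    using sq[OF that] by (simp add: power2_eq_iff[symmetric])
  then have "h ` unit_disc \<subseteq> {csqrt (a * d - b * c), - csqrt (a * d - b * c)}"
    by blast
  then have "finite (h ` unit_disc)" by (rule finite_subset) simp
  moreover have "continuous_on unit_disc h"
    unfolding h_def by (intro continuous_intros holomorphic_on_imp_continuous_on[OF s_hol])
  ultimately have "h constant_on unit_disc"
    by (intro continuous_finite_range_constant) auto
  then have "h z = h w" using assms by (auto simp: constant_on_def simp del: mem_ball_0)
  then show ?thesis
    using sq[OF assms(2)] by (simp add: h_def power2_eq_square)
qed

text \<open>Since \<open>\<sigma> w = (d * w - b) / (a - c * w)\<close>, this is the numerator of
  \<open>1 - \<sigma> w * \<sigma> z\<close> over the common denominator, namely
  \<open>(a - c * w) * (a - c * z) - (d * w - b) * (d * z - b)\<close>.\<close>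

definition Q :: "complex \<Rightarrow> complex \<Rightarrow> complex" where
  "Q w z = (c\<^sup>2 - d\<^sup>2) * w * z + (b * d - a * c) * (w + z) + (a\<^sup>2 - b\<^sup>2)"

lemma Q_\<tau>:
  assumes "w \<in> unit_disc" "z \<in> unit_disc"
  shows "Q (\<tau> w) (\<tau> z) = (a * d - b * c)\<^sup>2 * (1 - w * z) / ((c * w + d) * (c * z + d))"
proof -
  have ring: "(c\<^sup>2 - d\<^sup>2) * n * m + (b * d - a * c) * (n * y + m * x) + (a\<^sup>2 - b\<^sup>2) * (x * y)
      = (a * d - b * c)\<^sup>2 * (1 - w * z)"
    if "n = a * w + b" "m = a * z + b" "x = c * w + d" "y = c * z + d" for n m x y
    unfolding that by algebra
  have "Q (n / x) (m / y) = ((c\<^sup>2 - d\<^sup>2) * n * m + (b * d - a * c) * (n * y + m * x) + (a\<^sup>2 - b\<^sup>2) * (x * y)) / (x * y)"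
    if "x \<noteq> 0" "y \<noteq> 0" for n m x y
    using that by (simp add: Q_def field_simps)
  from this[OF denominator_nonzero[OF assms(1)] denominator_nonzero[OF assms(2)]] show ?thesis
    by (simp only: \<tau>_eq[OF assms(1)] \<tau>_eq[OF assms(2)] ring[OF refl refl refl refl])
qed

text \<open>The product \<open>s x * s y\<close> comes from \<open>s_mult\<close>, so the sign of
  the chosen branch disappears; one of the two determinant factors in \<open>Q_\<tau>\<close>
  cancels.\<close>

lemma kernel_eq:
  assumes w: "w \<in> \<Omega>" and z: "z \<in> \<Omega>"
  shows "kernel w z = (a * d - b * c) / Q w z" and Q_nonzero: "Q w z \<noteq> 0"
proof -
  define x y where "x = \<sigma> w" and "y = \<sigma> z"
  have xy: "x \<in> unit_disc" "y \<in> unit_disc" using \<sigma>_in w z by (auto simp: x_def y_def simp del: mem_ball_0)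
  have wz: "w = \<tau> x" "z = \<tau> y" by (simp_all add: x_def y_def \<tau>_\<sigma> w z)
  have "norm (x * y) < 1" by (rule norm_mult_less_1[OF xy])
  then have "1 - x * y \<noteq> 0" by auto
  then show "Q w z \<noteq> 0"
    using det_nonzero denominator_nonzero xy by (simp add: wz Q_\<tau> del: mem_ball_0)
  have "kernel w z = 1 / ((1 - x * y) * (s x * s y))"
    using xy z by (simp add: kernel_def V_inv_def szego_def x_def y_def)
  moreover have "s x * s y = (a * d - b * c) / ((c * x + d) * (c * y + d))"
    using s_mult[OF xy] denominator_nonzero[OF xy(1)] denominator_nonzero[OF xy(2)]
    by (simp add: nonzero_eq_divide_eq mult_ac)
  ultimately show "kernel w z = (a * d - b * c) / Q w z"
    using det_nonzero by (simp add: wz Q_\<tau>[OF xy] power2_eq_square)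
qed

section \<open>The functional equation for \<Phi> and its affine solutions\<close>

lemma comp_op_symmetric_iff_Q:
  assumes self: "\<Phi> ` \<Omega> \<subseteq> \<Omega>"
  shows "comp_op_J_symmetric \<Omega> \<tau> s \<Phi> \<longleftrightarrow>
    comp_op_bounded \<Omega> \<tau> \<Phi> \<and> (\<forall>w\<in>\<Omega>. \<forall>z\<in>\<Omega>. Q w (\<Phi> z) = Q (\<Phi> w) z)"
proof -
  have in\<Omega>: "\<Phi> w \<in> \<Omega>" if "w \<in> \<Omega>" for w using self that by auto
  have "comp_op \<Omega> \<Phi> (kernel w) = kernel (\<Phi> w) \<longleftrightarrow> (\<forall>z\<in>\<Omega>. Q w (\<Phi> z) = Q (\<Phi> w) z)"
    if w: "w \<in> \<Omega>" for w
  proof -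
    have "comp_op \<Omega> \<Phi> (kernel w) = kernel (\<Phi> w) \<longleftrightarrow> (\<forall>z\<in>\<Omega>. kernel w (\<Phi> z) = kernel (\<Phi> w) z)"
      by (auto simp: comp_op_def fun_eq_iff H_outside[OF kernel_in] in\<Omega> w)
    \<comment> \<open>Both kernel values are the same nonzero constant over a nonzero value of
      \<open>Q\<close>.\<close>
    also have "\<dots> \<longleftrightarrow> (\<forall>z\<in>\<Omega>. Q w (\<Phi> z) = Q (\<Phi> w) z)"
      using det_nonzero by (intro ball_cong refl) (simp add: kernel_eq Q_nonzero in\<Omega> w frac_eq_eq)
    finally show ?thesis .
  qed
  then show ?thesis using comp_op_kernel_iff[OF self] by auto
qed

text \<open>If \<open>c\<^sup>2 = d\<^sup>2\<close>, the bilinear term disappears and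
  \<open>\<Phi> w - w\<close> is constant. Otherwise the equation factors as \<open>(A * w + B) * (A
  * \<Phi> z + B) = (A * \<Phi> w + B) * (A * z + B)\<close>, so \<open>A * \<Phi> w + B\<close> is
  a constant multiple of \<open>A * w + B\<close>.\<close>

lemma Q_symmetric_imp_affine:
  assumes Q: "\<And>w z. w \<in> \<Omega> \<Longrightarrow> z \<in> \<Omega> \<Longrightarrow> Q w (\<Phi> z) = Q (\<Phi> w) z"
  shows "c\<^sup>2 = d\<^sup>2 \<Longrightarrow> \<exists>r. \<forall>w\<in>\<Omega>. \<Phi> w = w + r"
    and "c\<^sup>2 \<noteq> d\<^sup>2 \<Longrightarrow> \<exists>r. \<forall>w\<in>\<Omega>. \<Phi> w = r * w + (r - 1) * (b * d - a * c) / (c\<^sup>2 - d\<^sup>2)"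
proof -
  define A B where "A = c\<^sup>2 - d\<^sup>2" and "B = b * d - a * c"
  have \<tau>0: "\<tau> 0 \<in> \<Omega>" by (rule \<tau>_in) simp
  show "\<exists>r. \<forall>w\<in>\<Omega>. \<Phi> w = w + r" if eq: "c\<^sup>2 = d\<^sup>2"
  proof (intro exI ballI)
    fix w assume w: "w \<in> \<Omega>"
    \<comment> \<open>With \<open>d = c\<close> or \<open>d = - c\<close> this coefficient is the
      determinant up to sign.\<close>
    have "b * d - a * c \<noteq> 0" using eq det_nonzero by (auto simp: power2_eq_iff)
    moreover have "(b * d - a * c) * (\<tau> 0 + \<Phi> w) = (b * d - a * c) * (\<Phi> (\<tau> 0) + w)"
      using Q[OF \<tau>0 w] eq by (simp add: Q_def)
    ultimately have "\<tau> 0 + \<Phi> w = \<Phi> (\<tau> 0) + w" by simp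
    then show "\<Phi> w = w + (\<Phi> (\<tau> 0) - \<tau> 0)" by (simp add: algebra_simps)
  qed
  show "\<exists>r. \<forall>w\<in>\<Omega>. \<Phi> w = r * w + (r - 1) * (b * d - a * c) / (c\<^sup>2 - d\<^sup>2)" if "c\<^sup>2 \<noteq> d\<^sup>2"
  proof -
    have A: "A \<noteq> 0" using that by (simp add: A_def)
    have \<tau>h: "\<tau> (1 / 2) \<in> \<Omega>" by (rule \<tau>_in) simp
    \<comment> \<open>An affine function of nonzero slope vanishes at most once, so one of two
      distinct points of \<Omega> can serve as \<open>v\<close>.\<close>
    have "\<tau> 0 \<noteq> \<tau> (1 / 2)" using inj_onD[OF \<tau>_inj, of 0 "1 / 2"] by auto
    then have "A * \<tau> 0 \<noteq> A * \<tau> (1 / 2)" using A by simp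
    then obtain v where v: "v \<in> \<Omega>" "A * v + B \<noteq> 0"
      using \<tau>0 \<tau>h by (metis add_right_cancel)
    define r where "r = (A * \<Phi> v + B) / (A * v + B)"
    have "\<Phi> w = r * w + (r - 1) * B / A" if w: "w \<in> \<Omega>" for w
    proof -
      have "A * w * \<Phi> v + B * (w + \<Phi> v) = A * \<Phi> w * v + B * (\<Phi> w + v)"
        using Q[OF w v(1)] by (simp add: Q_def A_def B_def)
      \<comment> \<open>This is \<open>A\<close> times the previous equation with
        \<open>B\<^sup>2\<close> added to both sides.\<close>
      then have "(A * w + B) * (A * \<Phi> v + B) = (A * v + B) * (A * \<Phi> w + B)" by algebra
      then have "A * \<Phi> w + B = r * (A * w + B)"
        using v(2) by (simp add: r_def field_simps)
      then show ?thesis using A by (simp add: field_simps)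
    qed
    then show ?thesis unfolding A_def B_def by blast
  qed
qed

lemma affine_imp_Q_symmetric:
  assumes "c\<^sup>2 = d\<^sup>2 \<and> (\<forall>w\<in>\<Omega>. \<Phi> w = w + r) \<or>
      c\<^sup>2 \<noteq> d\<^sup>2 \<and> (\<forall>w\<in>\<Omega>. \<Phi> w = r * w + (r - 1) * (b * d - a * c) / (c\<^sup>2 - d\<^sup>2))"
    and w: "w \<in> \<Omega>" and z: "z \<in> \<Omega>"
  shows "Q w (\<Phi> z) = Q (\<Phi> w) z"
  using assms(1)
proof (elim disjE conjE)
  assume "c\<^sup>2 \<noteq> d\<^sup>2" and \<Phi>: "\<forall>w\<in>\<Omega>. \<Phi> w = r * w + (r - 1) * (b * d - a * c) / (c\<^sup>2 - d\<^sup>2)"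
  \<comment> \<open>The shift \<open>q\<close> is the one for which
    \<open>A * \<Phi> w + B = r * (A * w + B)\<close>, where
    \<open>A = c\<^sup>2 - d\<^sup>2\<close> and \<open>B = b * d - a * c\<close>.\<close>
  define q where "q = (r - 1) * (b * d - a * c) / (c\<^sup>2 - d\<^sup>2)"
  have "(c\<^sup>2 - d\<^sup>2) * q = (r - 1) * (b * d - a * c)"
    using \<open>c\<^sup>2 \<noteq> d\<^sup>2\<close> by (simp add: q_def)
  moreover have "\<Phi> w = r * w + q" "\<Phi> z = r * z + q" using \<Phi> w z by (auto simp: q_def)
  ultimately show ?thesis unfolding Q_def by algebra
qed (use w z in \<open>simp add: Q_def algebra_simps\<close>)

end

theorem proposition5p3:
  fixes \<Omega> :: "complex set" and \<tau> s :: "complex \<Rightarrow> complex" and a b c d :: real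
  assumes "open \<Omega>" and "simply_connected \<Omega>" and "\<Omega> \<noteq> UNIV"
    and "linear_fractional_riemann_map \<Omega> \<tau>
           (complex_of_real a) (complex_of_real b) (complex_of_real c) (complex_of_real d)"
    and "s holomorphic_on unit_disc"
    and "\<And>z. z \<in> unit_disc \<Longrightarrow> (s z)\<^sup>2 = deriv \<tau> z"
  shows "(\<forall>\<Phi> :: complex \<Rightarrow> complex.
            \<Phi> holomorphic_on \<Omega> \<and> \<Phi> ` \<Omega> \<subseteq> \<Omega> \<and> comp_op_J_symmetric \<Omega> \<tau> s \<Phi> \<longrightarrow>
              (\<bar>c\<bar>\<^sup>2 = \<bar>d\<bar>\<^sup>2 \<longrightarrow> (\<exists>r :: complex. \<forall>w\<in>\<Omega>. \<Phi> w = w + r)) \<and>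
              (\<bar>c\<bar>\<^sup>2 \<noteq> \<bar>d\<bar>\<^sup>2 \<longrightarrow> (\<exists>r :: complex. \<forall>w\<in>\<Omega>.
                 \<Phi> w = r * w + (r - 1) * complex_of_real (b * d - a * c)
                                 / complex_of_real (\<bar>c\<bar>\<^sup>2 - \<bar>d\<bar>\<^sup>2)))) \<and>
         (\<forall>(\<Phi> :: complex \<Rightarrow> complex) (r :: complex).
            (\<bar>c\<bar>\<^sup>2 = \<bar>d\<bar>\<^sup>2 \<and> (\<forall>w\<in>\<Omega>. \<Phi> w = w + r) \<or>
             \<bar>c\<bar>\<^sup>2 \<noteq> \<bar>d\<bar>\<^sup>2 \<and> (\<forall>w\<in>\<Omega>.
                 \<Phi> w = r * w + (r - 1) * complex_of_real (b * d - a * c)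
                                 / complex_of_real (\<bar>c\<bar>\<^sup>2 - \<bar>d\<bar>\<^sup>2))) \<and>
            \<Phi> ` \<Omega> \<subseteq> \<Omega> \<and> comp_op_bounded \<Omega> \<tau> \<Phi> \<longrightarrow>
              comp_op_J_symmetric \<Omega> \<tau> s \<Phi>)"
proof -
  interpret linear_fractional_hardy_smirnov \<Omega> \<tau> s a b c d
    using assms by unfold_locales
  \<comment> \<open>For real \<open>c\<close> and \<open>d\<close> the squared moduli are the
    squares themselves, which is the form used for complex coefficients.\<close>
  have sq_iff: "\<bar>c\<bar>\<^sup>2 = \<bar>d\<bar>\<^sup>2 \<longleftrightarrow> (of_real c)\<^sup>2 = ((of_real d)\<^sup>2 :: complex)"
    by (simp flip: of_real_power)
  have coeffs: "complex_of_real (b * d - a * c) = of_real b * of_real d - of_real a * of_real c"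
    "complex_of_real (\<bar>c\<bar>\<^sup>2 - \<bar>d\<bar>\<^sup>2) = (of_real c)\<^sup>2 - (of_real d)\<^sup>2"
    by simp_all
  show ?thesis
    unfolding sq_iff coeffs
  proof (intro conjI allI impI; elim conjE)
    fix \<Phi> assume "\<Phi> ` \<Omega> \<subseteq> \<Omega>" "comp_op_J_symmetric \<Omega> \<tau> s \<Phi>"
    then have "Q w (\<Phi> z) = Q (\<Phi> w) z" if "w \<in> \<Omega>" "z \<in> \<Omega>" for w z
      using that comp_op_symmetric_iff_Q by blast
    note affine = Q_symmetric_imp_affine[of \<Phi>, OF this]
    show "\<exists>r. \<forall>w\<in>\<Omega>. \<Phi> w = w + r" if "(of_real c)\<^sup>2 = ((of_real d)\<^sup>2 :: complex)"
      by (rule affine(1)[OF _ _ that])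
    show "\<exists>r. \<forall>w\<in>\<Omega>. \<Phi> w = r * w + (r - 1) * (of_real b * of_real d - of_real a * of_real c)
        / ((of_real c)\<^sup>2 - (of_real d)\<^sup>2)" if "(of_real c)\<^sup>2 \<noteq> ((of_real d)\<^sup>2 :: complex)"
      by (rule affine(2)[OF _ _ that])
  next
    fix \<Phi> r
    assume "\<Phi> ` \<Omega> \<subseteq> \<Omega>" "comp_op_bounded \<Omega> \<tau> \<Phi>"
      and affine: "(of_real c)\<^sup>2 = ((of_real d)\<^sup>2 :: complex) \<and> (\<forall>w\<in>\<Omega>. \<Phi> w = w + r) \<or>
        (of_real c)\<^sup>2 \<noteq> ((of_real d)\<^sup>2 :: complex) \<and> (\<forall>w\<in>\<Omega>. \<Phi> w = r * w +
          (r - 1) * (of_real b * of_real d - of_real a * of_real c) / ((of_real c)\<^sup>2 - (of_real d)\<^sup>2))"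
    then show "comp_op_J_symmetric \<Omega> \<tau> s \<Phi>"
      using affine_imp_Q_symmetric[OF affine] comp_op_symmetric_iff_Q by blast
  qed
qed

end
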